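(* Let $\mathcal{X}$ be a finite state space, $\pi$ a probability mass function on $\mathcal{X}$ with $\min_x\pi(x)>0$, $P \in \mathcal{S}(\pi)$ and $Q \in \mathcal{I}(\pi) \cap \mathcal{L}$ (an isometric involution transition matrix). Let $\overline{P} = \overline{P}(Q) := \frac12(P + QP^*Q)$. Then for every $L \in \mathcal{L}(\pi,Q)$, $$ {}^Q D_{KL}(P \| L) = {}^Q D_{KL}(P \| \overline{P}) + {}^Q D_{KL}(\overline{P} \| L), $$ $$ D_{KL}^Q(P \| L) = D_{KL}^Q(P \| \overline{P}) + D_{KL}^Q(\overline{P} \| L). $$
   Context: $\mathcal{L}$ is the set of transition (row-stochastic) matrices on $\mathcal{X}$; $\mathcal{S}(\pi)\subseteq\mathcal{L}$ is the set of those $P$ with $\pi P=\pi$. For a matrix $M$, $M^*(x,y)=\frac{\pi(y)}{\pi(x)}M(y,x)$ is its $\ell^2(\pi)$-adjoint. $\mathcal{I}(\pi)$ is the set of real matrices $Q$ on $\mathcal{X}$ with $Q^2=I$ and $Q^*=Q$. $\mathcal{L}(\pi,Q)$ is the set of $L\in\mathcal{S}(\pi)$ with $L^*=QLQ$. For $M,N\in\mathcal{L}$, $D^\pi_{KL}(M\|N):=\sum_x\pi(x)\sum_y M(x,y)\ln\frac{M(x,y)}{N(x,y)}\in[0,\infty]$, with $0\ln(0/0)=0$, $0\cdot\infty=0$ and $a\ln(a/0)=+\infty$ for $a>0$. The deformed divergences are ${}^QD_{KL}(P\|L):=D^\pi_{KL}(QP\|QL)$ and $D^Q_{KL}(P\|L):=D^\pi_{KL}(PQ\|LQ)$.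 *)

theory Defs
  imports "HOL-Analysis.Analysis"
begin

text \<open>
  The state space is a finite type. Matrices and row vectors over it are the library's
  Cartesian-product types; \<open>M $ x $ y\<close> is the entry in row \<open>x\<close> and column \<open>y\<close>, and \<open>\<pi> v* M\<close> is
  the row vector \<open>\<pi> M\<close>.
\<close>

definition prob_mass_function :: "real ^ 'x::finite \<Rightarrow> bool" where
  "prob_mass_function \<pi> \<longleftrightarrow> (\<forall>x. 0 \<le> \<pi> $ x) \<and> (\<Sum>x\<in>UNIV. \<pi> $ x) = 1"

definition transition_matrices :: "(real ^ 'x::finite ^ 'x) set" where
  "transition_matrices = {M. (\<forall>x y. 0 \<le> M $ x $ y) \<and> (\<forall>x. (\<Sum>y\<in>UNIV. M $ x $ y) = 1)}"

definition stationary_matrices :: "real ^ 'x::finite \<Rightarrow> (real ^ 'x ^ 'x) set" where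
  "stationary_matrices \<pi> = {P \<in> transition_matrices. \<pi> v* P = \<pi>}"

text \<open>The adjoint in \<open>\<ell>\<^sup>2(\<pi>)\<close>, for \<open>\<pi>\<close> with strictly positive entries.\<close>

definition adj_wrt :: "real ^ 'x::finite \<Rightarrow> real ^ 'x ^ 'x \<Rightarrow> real ^ 'x ^ 'x" where
  "adj_wrt \<pi> M = (\<chi> x y. \<pi> $ y / \<pi> $ x * M $ y $ x)"

definition isometric_involutions :: "real ^ 'x::finite \<Rightarrow> (real ^ 'x ^ 'x) set" where
  "isometric_involutions \<pi> = {Q. Q ** Q = mat 1 \<and> adj_wrt \<pi> Q = Q}"

definition Q_reversible_matrices ::
  "real ^ 'x::finite \<Rightarrow> real ^ 'x ^ 'x \<Rightarrow> (real ^ 'x ^ 'x) set" where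
  "Q_reversible_matrices \<pi> Q = {L \<in> stationary_matrices \<pi>. adj_wrt \<pi> L = Q ** L ** Q}"

text \<open>
  The summand \<open>a ln (a / b)\<close> for \<open>a, b \<ge> 0\<close>, with \<open>0 ln (0 / b) = 0\<close> (also for \<open>b = 0\<close>) and
  \<open>a ln (a / 0) = \<infinity>\<close> for \<open>a > 0\<close>. The case distinction is needed because division by zero
  is \<open>0\<close> in HOL. The value \<open>-\<infinity>\<close> never occurs, so the sums below are unambiguous.
\<close>

definition kl_term :: "real \<Rightarrow> real \<Rightarrow> ereal" where
  "kl_term a b = (if a = 0 then 0 else if b = 0 then \<infinity> else ereal (a * ln (a / b)))"

definition KL_div :: "real ^ 'x::finite \<Rightarrow> real ^ 'x ^ 'x \<Rightarrow> real ^ 'x ^ 'x \<Rightarrow> ereal" where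
  "KL_div \<pi> M N = (\<Sum>x\<in>UNIV. ereal (\<pi> $ x) * (\<Sum>y\<in>UNIV. kl_term (M $ x $ y) (N $ x $ y)))"

definition KL_div_left ::
  "real ^ 'x::finite \<Rightarrow> real ^ 'x ^ 'x \<Rightarrow> real ^ 'x ^ 'x \<Rightarrow> real ^ 'x ^ 'x \<Rightarrow> ereal" where
  "KL_div_left \<pi> Q P L = KL_div \<pi> (Q ** P) (Q ** L)"

definition KL_div_right ::
  "real ^ 'x::finite \<Rightarrow> real ^ 'x ^ 'x \<Rightarrow> real ^ 'x ^ 'x \<Rightarrow> real ^ 'x ^ 'x \<Rightarrow> ereal" where
  "KL_div_right \<pi> Q P L = KL_div \<pi> (P ** Q) (L ** Q)"

definition Q_average ::
  "real ^ 'x::finite \<Rightarrow> real ^ 'x ^ 'x \<Rightarrow> real ^ 'x ^ 'x \<Rightarrow> real ^ 'x ^ 'x" where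
  "Q_average \<pi> Q P = (1 / 2) *\<^sub>R (P + Q ** adj_wrt \<pi> P ** Q)"

end

theory Submission
  imports Defs
begin

text \<open>
  Since \<open>Q\<close> is a self-adjoint involution, \<open>QL\<close> and \<open>LQ\<close> are self-adjoint whenever
  \<open>L\<^sup>* = QLQ\<close>, while \<open>Q\<close> times the average of \<open>P\<close> is \<open>(QP + (QP)\<^sup>*) / 2\<close>, and similarly on
  the right. So both identities are the Pythagorean identity for the symmetrisation
  \<open>A = (M + M\<^sup>*) / 2\<close> of a nonnegative matrix \<open>M\<close> relative to a self-adjoint \<open>K\<close>. There
  \<open>ln (A / K)\<close> is a symmetric function of \<open>(x, y)\<close>, because \<open>\<pi>(x) A(x, y)\<close> and
  \<open>\<pi>(x) K(x, y)\<close> are, so its integrals against \<open>\<pi>(x) M(x, y)\<close> and \<open>\<pi>(x) A(x, y)\<close> agree.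
\<close>

lemma adj_wrt_nth: "adj_wrt \<pi> M $ x $ y = \<pi> $ y / \<pi> $ x * M $ y $ x"
  by (simp add: adj_wrt_def)

lemma adj_wrt_matrix_mult:
  fixes \<pi> :: "real ^ 'x::finite"
  assumes "\<And>x. \<pi> $ x \<noteq> 0"
  shows "adj_wrt \<pi> (M ** N) = adj_wrt \<pi> N ** adj_wrt \<pi> M"
  using assms
  by (simp add: vec_eq_iff adj_wrt_nth matrix_matrix_mult_def sum_distrib_left mult_ac)

lemma matrix_add_rdistrib:
  fixes A B C :: "real ^ 'x::finite ^ 'x"
  shows "(A + B) ** C = A ** C + B ** C"
  by (simp add: vec_eq_iff matrix_matrix_mult_def distrib_right sum.distrib)

lemma matrix_mult_nonneg:
  fixes M N :: "real ^ 'x::finite ^ 'x"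
  assumes "\<And>x y. 0 \<le> M $ x $ y" and "\<And>x y. 0 \<le> N $ x $ y"
  shows "0 \<le> (M ** N) $ x $ y"
  by (simp add: matrix_matrix_mult_def sum_nonneg assms)

text \<open>Absolute continuity excludes the infinite case of \<open>kl_term\<close>; where
  \<open>M\<close> vanishes, the real summand is 0 because of its factor
  \<open>M $ x $ y\<close>.\<close>

lemma KL_div_finite:
  assumes "\<And>x y. N $ x $ y = 0 \<Longrightarrow> M $ x $ y = 0"
  shows "KL_div \<pi> M N = ereal (\<Sum>x\<in>UNIV. \<pi> $ x * (\<Sum>y\<in>UNIV. M $ x $ y * ln (M $ x $ y / N $ x $ y)))"
proof -
  have "kl_term (M $ x $ y) (N $ x $ y) = ereal (M $ x $ y * ln (M $ x $ y / N $ x $ y))" for x y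
    using assms by (auto simp: kl_term_def)
  then show ?thesis
    by (simp add: KL_div_def)
qed

text \<open>One infinite entry decides the sum; its row weight must be positive, since 0 times
  \<infinity> is 0 in \<open>ereal\<close>.\<close>

lemma KL_div_infinite:
  assumes "\<And>x. 0 < \<pi> $ x" and "N $ x $ y = 0" and "M $ x $ y \<noteq> 0"
  shows "KL_div \<pi> M N = \<infinity>"
proof -
  have "kl_term (M $ x $ y) (N $ x $ y) = \<infinity>"
    using assms by (simp add: kl_term_def)
  then have "(\<Sum>y\<in>UNIV. kl_term (M $ x $ y) (N $ x $ y)) = \<infinity>"
    by (auto simp: sum_Pinfty)
  then have "ereal (\<pi> $ x) * (\<Sum>y\<in>UNIV. kl_term (M $ x $ y) (N $ x $ y)) = \<infinity>"
    using assms(1)[of x] by simp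
  then show ?thesis
    unfolding KL_div_def sum_Pinfty by auto
qed

lemma KL_div_symmetrisation:
  fixes \<pi> :: "real ^ 'x::finite"
  assumes pos: "\<And>x. 0 < \<pi> $ x"
    and M: "\<And>x y. 0 \<le> M $ x $ y"
    and K: "\<And>x y. 0 \<le> K $ x $ y"
    and sa: "adj_wrt \<pi> K = K"
  defines "A \<equiv> (1 / 2) *\<^sub>R (M + adj_wrt \<pi> M)"
  shows "KL_div \<pi> M K = KL_div \<pi> M A + KL_div \<pi> A K"
proof -
  have A: "A $ x $ y = (M $ x $ y + \<pi> $ y / \<pi> $ x * M $ y $ x) / 2" for x y
    by (simp add: A_def adj_wrt_nth)
  have K_flip: "K $ x $ y = \<pi> $ y / \<pi> $ x * K $ y $ x" for x y
    using sa by (metis adj_wrt_nth)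
  have A_flip: "A $ x $ y = \<pi> $ y / \<pi> $ x * A $ y $ x" for x y
    using pos[of x] pos[of y] by (simp add: A field_simps)
  have M_adj_nonneg: "0 \<le> \<pi> $ y / \<pi> $ x * M $ y $ x" for x y
    using M pos by (simp add: less_imp_le)
  have A_nonneg: "0 \<le> A $ x $ y" for x y
    using M M_adj_nonneg[where x = x and y = y] by (simp add: A)
  \<comment> \<open>A sum of two nonnegative terms vanishes only if both do, so the divergence of
    \<open>M\<close> from \<open>A\<close> is always finite.\<close>
  have MA: "M $ x $ y = 0" if "A $ x $ y = 0" for x y
    using that M[of x y] M_adj_nonneg[where x = x and y = y] by (simp add: A)
  have fin: "KL_div \<pi> M A = ereal (\<Sum>x\<in>UNIV. \<pi> $ x * (\<Sum>y\<in>UNIV. M $ x $ y * ln (M $ x $ y / A $ x $ y)))"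
    using MA by (rule KL_div_finite)
  show ?thesis
  \<comment> \<open>If \<open>K\<close> vanishes where \<open>M\<close> does not, then
    \<open>A\<close> is nonzero there too, and both sides are infinite.\<close>
  proof (cases "\<exists>x y. K $ x $ y = 0 \<and> M $ x $ y \<noteq> 0")
    case True
    then obtain x y where xy: "K $ x $ y = 0" "M $ x $ y \<noteq> 0"
      by blast
    then have "KL_div \<pi> M K = \<infinity>" "KL_div \<pi> A K = \<infinity>"
      using MA pos by (blast intro: KL_div_infinite)+
    then show ?thesis
      by (simp add: fin)
  next
    case False
    then have MK: "M $ x $ y = 0" if "K $ x $ y = 0" for x y
      using that by blast
    \<comment> \<open>The zero pattern of \<open>K\<close> is symmetric by self-adjointness, so both
      \<open>M $ x $ y\<close> and \<open>M $ y $ x\<close> vanish.\<close>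
    have AK: "A $ x $ y = 0" if "K $ x $ y = 0" for x y
      using that MK[of x y] MK[of y x] K_flip[of y x] by (simp add: A)
    define g where "g x y = ln (A $ x $ y / K $ x $ y)" for x y
    have g_sym: "g x y = g y x" for x y
    proof -
      \<comment> \<open>Flipping the indices multiplies \<open>A\<close> and \<open>K\<close> by the
        same factor, which cancels.\<close>
      have "A $ x $ y / K $ x $ y = A $ y $ x / K $ y $ x"
        using pos[of x] pos[of y] by (subst A_flip, subst K_flip) auto
      then show ?thesis
        by (simp add: g_def)
    qed
    have split: "M $ x $ y * ln (M $ x $ y / K $ x $ y)
        = M $ x $ y * ln (M $ x $ y / A $ x $ y) + M $ x $ y * g x y" for x y
    proof (cases "M $ x $ y = 0")
      case False
      then have "M $ x $ y > 0" "A $ x $ y > 0" "K $ x $ y > 0"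
        using M[of x y] A_nonneg[of x y] K[of x y] MA[of x y] MK[of x y] by force+
      then show ?thesis
        by (simp add: g_def ln_div algebra_simps)
    qed simp
    \<comment> \<open>Renaming the summation indices moves the flip from \<open>M\<close> to
      \<open>g\<close>, where it has no effect.\<close>
    have swap: "(\<Sum>x\<in>UNIV. \<Sum>y\<in>UNIV. \<pi> $ y * M $ y $ x * g x y)
        = (\<Sum>x\<in>UNIV. \<Sum>y\<in>UNIV. \<pi> $ x * M $ x $ y * g x y)"
      by (subst sum.swap) (simp add: g_sym)
    have "(\<Sum>x\<in>UNIV. \<pi> $ x * (\<Sum>y\<in>UNIV. A $ x $ y * g x y))
        = (\<Sum>x\<in>UNIV. \<Sum>y\<in>UNIV. (\<pi> $ x * M $ x $ y * g x y + \<pi> $ y * M $ y $ x * g x y) / 2)"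
      unfolding sum_distrib_left
    proof (intro sum.cong refl)
      fix x y
      show "\<pi> $ x * (A $ x $ y * g x y)
          = (\<pi> $ x * M $ x $ y * g x y + \<pi> $ y * M $ y $ x * g x y) / 2"
        using pos[of x] by (simp add: A field_simps)
    qed
    also have "\<dots> = (\<Sum>x\<in>UNIV. \<pi> $ x * (\<Sum>y\<in>UNIV. M $ x $ y * g x y))"
      by (simp only: add_divide_distrib sum.distrib flip: sum_divide_distrib)
        (simp add: swap sum_distrib_left flip: mult.assoc)
    finally have "(\<Sum>x\<in>UNIV. \<pi> $ x * (\<Sum>y\<in>UNIV. A $ x $ y * g x y))
        = (\<Sum>x\<in>UNIV. \<pi> $ x * (\<Sum>y\<in>UNIV. M $ x $ y * g x y))" .
    then show ?thesis
      by (simp only: fin KL_div_finite[OF MK] KL_div_finite[OF AK] split flip: g_def)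
        (simp add: sum.distrib distrib_left)
  qed
qed

theorem proposition2p3:
  fixes \<pi> :: "real ^ 'x::finite"
    and P Q :: "real ^ 'x ^ 'x"
  assumes "prob_mass_function \<pi>"
    and "Min (range (\<lambda>x. \<pi> $ x)) > 0"
    and "P \<in> stationary_matrices \<pi>"
    and "Q \<in> isometric_involutions \<pi> \<inter> transition_matrices"
  shows "\<forall>L \<in> Q_reversible_matrices \<pi> Q.
      KL_div_left \<pi> Q P L
        = KL_div_left \<pi> Q P (Q_average \<pi> Q P) + KL_div_left \<pi> Q (Q_average \<pi> Q P) L
    \<and> KL_div_right \<pi> Q P L
        = KL_div_right \<pi> Q P (Q_average \<pi> Q P) + KL_div_right \<pi> Q (Q_average \<pi> Q P) L"
proof
  fix L assume L: "L \<in> Q_reversible_matrices \<pi> Q"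
  have pos: "0 < \<pi> $ x" for x
    using assms(2) by simp
  then have adj: "adj_wrt \<pi> (M ** N) = adj_wrt \<pi> N ** adj_wrt \<pi> M" for M N
    by (intro adj_wrt_matrix_mult) (metis less_irrefl)
  have QQ: "Q ** Q = mat 1" and Q_adj: "adj_wrt \<pi> Q = Q"
    using assms(4) by (auto simp: isometric_involutions_def)
  have QQ_cancel: "Q ** (Q ** M) = M" for M
    by (simp add: matrix_mul_assoc QQ)
  have L_adj: "adj_wrt \<pi> L = Q ** (L ** Q)"
    using L by (simp add: Q_reversible_matrices_def matrix_mul_assoc)
  have nonneg: "0 \<le> Q $ x $ y" "0 \<le> P $ x $ y" "0 \<le> L $ x $ y" for x y
    using assms(3,4) L
    by (auto simp: stationary_matrices_def transition_matrices_def Q_reversible_matrices_def)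
  \<comment> \<open>Here Q(QP*Q) = P*Q = (QP)*.\<close>
  have "Q ** Q_average \<pi> Q P = (1 / 2) *\<^sub>R (Q ** P + adj_wrt \<pi> (Q ** P))"
    by (simp add: Q_average_def adj Q_adj matrix_scalar_ac matrix_add_ldistrib QQ_cancel
        scaleR_add_right
        flip: matrix_mul_assoc scalar_matrix_assoc)
  \<comment> \<open>Here (QP*Q)Q = QP* = (PQ)*.\<close>
  moreover have "Q_average \<pi> Q P ** Q = (1 / 2) *\<^sub>R (P ** Q + adj_wrt \<pi> (P ** Q))"
    by (simp add: Q_average_def adj Q_adj matrix_add_rdistrib QQ flip: matrix_mul_assoc
        scalar_matrix_assoc)
  \<comment> \<open>(QL)* = L*Q = QLQQ = QL; likewise (LQ)* = QL* = QQLQ = LQ below.\<close>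
  moreover have "adj_wrt \<pi> (Q ** L) = Q ** L"
    by (simp add: adj Q_adj L_adj QQ flip: matrix_mul_assoc)
  moreover have "adj_wrt \<pi> (L ** Q) = L ** Q"
    by (simp add: adj Q_adj L_adj QQ_cancel)
  ultimately show "KL_div_left \<pi> Q P L
        = KL_div_left \<pi> Q P (Q_average \<pi> Q P) + KL_div_left \<pi> Q (Q_average \<pi> Q P) L
    \<and> KL_div_right \<pi> Q P L
        = KL_div_right \<pi> Q P (Q_average \<pi> Q P) + KL_div_right \<pi> Q (Q_average \<pi> Q P) L"
    unfolding KL_div_left_def KL_div_right_def
    by (simp add: KL_div_symmetrisation pos matrix_mult_nonneg nonneg)
qed

end
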